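(* Let $d\ge1$ and let $\Box_d\subset\mathbb{R}^d$ be a perfectly centered cube of dimension $d$, with dual $\Box_d^*$. Then for $0\le k\le d-1$, $$f_k(\Box_d+\Box_d^* )=\binom{d}{k+1}\,2^{d-k-1}\left(3^{k+1}-1\right).$$
   Context: $f_k(Q)$ is the number of $k$-dimensional faces of a polytope $Q$; $+$ denotes Minkowski sum; the dual of a polytope $P\subset\mathbb{R}^d$ containing the origin in its interior is $P^*=\{x:\langle x,y\rangle\le1\ \forall y\in P\}$. For a nonempty face $F$ of $P$, the outer normal cone $\mathcal{N}(F;P)$ is the set of $c\in\mathbb{R}^d$ such that $F$ is exactly the set of maximizers of $\langle\cdot,c\rangle$ over $P$. A full-dimensional polytope $P\subset\mathbb{R}^d$ is perfectly centered if $\mathrm{relint}(F)\cap\mathcal{N}(F;P)\neq\emptyset$ for every nonempty face $F$ of $P$ (including $F=P$, where $\mathcal{N}(P;P)=\{0\}$, so the origin is in the interior of $P$). *)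

theory Defs
  imports "HOL-Analysis.Analysis"
begin

definition face_number :: "nat \<Rightarrow> 'a::euclidean_space set \<Rightarrow> nat" where
  "face_number k Q = card {F. F face_of Q \<and> aff_dim F = int k}"

definition dual_body :: "'a::euclidean_space set \<Rightarrow> 'a set" where
  "dual_body P = {x. \<forall>y\<in>P. x \<bullet> y \<le> 1}"

definition outer_normal_cone :: "'a::euclidean_space set \<Rightarrow> 'a set \<Rightarrow> 'a set" where
  "outer_normal_cone F P = {c. F = {x \<in> P. \<forall>y\<in>P. y \<bullet> c \<le> x \<bullet> c}}"

definition perfectly_centered :: "'a::euclidean_space set \<Rightarrow> bool" where
  "perfectly_centered P \<longleftrightarrow>
     polytope P \<and> aff_dim P = int DIM('a) \<and>
     (\<forall>F. F face_of P \<and> F \<noteq> {} \<longrightarrow> rel_interior F \<inter> outer_normal_cone F P \<noteq> {})"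

definition combinatorially_equivalent ::
    "'a::euclidean_space set \<Rightarrow> 'b::euclidean_space set \<Rightarrow> bool" where
  "combinatorially_equivalent P Q \<longleftrightarrow>
     (\<exists>\<phi>. bij_betw \<phi> {F. F face_of P} {G. G face_of Q} \<and>
          (\<forall>F F'. F face_of P \<and> F' face_of P \<longrightarrow> (F \<subseteq> F' \<longleftrightarrow> \<phi> F \<subseteq> \<phi> F')))"

(* "Cube" is meant combinatorially: any polytope with the face lattice of [-1,1]^d, where
   d = DIM('a). Geometric cubes, boxes and parallelotopes are instances, see is_cube_affine_image. *)
definition is_cube :: "'a::euclidean_space set \<Rightarrow> bool" where
  "is_cube P \<longleftrightarrow> polytope P \<and> combinatorially_equivalent P (cbox (- One) One :: 'a set)"

lemma is_cube_affine_image: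
  fixes f :: "'a::euclidean_space \<Rightarrow> 'a"
  assumes "linear f" "inj f"
  shows "is_cube ((+) c ` f ` cbox (- One) One)"
proof -
  let ?S = "cbox (- One) One :: 'a set"
  let ?h = "\<lambda>F. (+) c ` f ` F"
  have inj: "inj (\<lambda>x. c + f x)" using assms(2) by (auto simp: inj_on_def)
  have sub: "?h F \<subseteq> ?h G \<longleftrightarrow> F \<subseteq> G" for F G
    using inj by (simp add: image_image inj_image_subset_iff)
  have eqv: "?h F = ?h G \<longleftrightarrow> F = G" for F G using sub by blast
  have f: "?h F face_of ?h ?S \<longleftrightarrow> F face_of ?S" for F
    using face_of_linear_image[OF assms] by simp
  have faces: "{G. G face_of ?h ?S} = ?h ` {F. F face_of ?S}"
  proof (intro equalityI subsetI)
    fix G assume "G \<in> {G. G face_of ?h ?S}"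
    moreover then obtain F where "G = ?h F"
      by (metis face_of_imp_subset image_image mem_Collect_eq subset_imageE)
    ultimately show "G \<in> ?h ` {F. F face_of ?S}" using f by blast
  qed (use f in auto)
  have b: "bij_betw ?h {F. F face_of ?S} {G. G face_of ?h ?S}"
    unfolding faces bij_betw_def by (intro conjI refl inj_onI) (use eqv in blast)
  let ?g = "the_inv_into {F. F face_of ?S} ?h"
  have "combinatorially_equivalent (?h ?S) ?S"
    unfolding combinatorially_equivalent_def
    apply (rule exI[of _ ?g], intro conjI)
    apply (rule bij_betw_the_inv_into[OF b])
    using sub f_the_inv_into_f_bij_betw[OF b] by (metis (no_types, lifting) mem_Collect_eq)
  moreover have "polytope (?h ?S)"
    by (simp add: polytope_interval polytope_linear_image assms polytope_translation_eq)
  ultimately show ?thesis by (simp add: is_cube_def)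
qed

end

theory Submission
  imports Defs
begin

text \<open>A proper face of \<open>P + P*\<close> is the set of maximizers of some \<open>c \<noteq> 0\<close>, hence \<open>G + F\<^sup>D\<close> where \<open>G\<close>
  maximizes \<open>c\<close> over \<open>P\<close> and a positive multiple of \<open>c\<close> lies in the relative interior of the
  proper face \<open>F\<close> of \<open>P\<close>. For perfectly centered \<open>P\<close>, a pair \<open>(G, F)\<close> arises in this way iff
  \<open>G \<subseteq> F\<close>; given such a flag, \<open>c\<close> can be taken to be the sum of the centers of \<open>G\<close> and \<open>F\<close>.
  As \<open>G\<close> and \<open>F\<^sup>D\<close> lie in orthogonal directions, the face has dimension
  \<open>dim G + (d - 1 - dim F)\<close>. So \<open>f\<^sub>k\<close> counts flags of \<open>P\<close>, which depend only on the face lattice,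
  and the flags of the standard cube are counted through sign vectors.\<close>

section \<open>Faces as sets of maximizers\<close>

text \<open>The outer normal cone read in the other direction:
  \<open>c \<in> outer_normal_cone F S\<close> iff \<open>F = max_face S c\<close>, so every vector
  selects one face.\<close>

definition max_face :: "'a::euclidean_space set \<Rightarrow> 'a \<Rightarrow> 'a set" where
  "max_face S c = {x \<in> S. \<forall>y\<in>S. y \<bullet> c \<le> x \<bullet> c}"

lemma max_face_subset: "max_face S c \<subseteq> S"
  by (auto simp: max_face_def)

lemma max_face_0 [simp]: "max_face S 0 = S"
  by (auto simp: max_face_def)

lemma max_face_scaleR: "r > 0 \<Longrightarrow> max_face S (r *\<^sub>R c) = max_face S c"
  by (auto simp: max_face_def)

lemma max_face_nonempty:
  assumes "compact S" "S \<noteq> {}"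
  shows "max_face S c \<noteq> {}"
proof -
  have "continuous_on S (\<lambda>x. x \<bullet> c)"
    by (intro continuous_intros)
  from continuous_attains_sup[OF assms this] show ?thesis
    by (auto simp: max_face_def)
qed

lemma max_face_face_of:
  assumes "convex S"
  shows "max_face S c face_of S"
proof (cases "max_face S c = {}")
  case False
  then obtain x where x: "x \<in> S" "\<And>y. y \<in> S \<Longrightarrow> y \<bullet> c \<le> x \<bullet> c"
    by (auto simp: max_face_def)
  then have "max_face S c = S \<inter> {y. c \<bullet> y = c \<bullet> x}"
    by (auto simp: max_face_def inner_commute[of c] intro: antisym)
  then show ?thesis
    using face_of_Int_supporting_hyperplane_le[OF assms, of c "c \<bullet> x"] x(2)
    by (simp add: inner_commute[of c])
qed simp

text \<open>Faces of polytopes are exposed. Since \<open>F\<close> is nonempty, the bound of the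
  supporting halfspace is attained in \<open>S\<close>, so the normal of its hyperplane is maximized
  exactly on \<open>F\<close>.\<close>

lemma face_of_polytope_eq_max_face:
  assumes "polytope S" "F face_of S" "F \<noteq> {}"
  obtains c where "F = max_face S c"
proof -
  have "F exposed_face_of S"
    using assms exposed_face_of_polyhedron polytope_imp_polyhedron by blast
  then obtain a b where ab: "S \<subseteq> {x. a \<bullet> x \<le> b}" "F = S \<inter> {x. a \<bullet> x = b}"
    by (auto simp: exposed_face_of_def)
  obtain z where z: "z \<in> S" "a \<bullet> z = b"
    using ab(2) assms(3) by blast
  have "F = max_face S a"
    unfolding max_face_def ab(2) using ab(1) z
    by (auto simp: inner_commute[of _ a] intro!: antisym)
  then show thesis by (rule that)
qed

section \<open>Faces and dimension of Minkowski sums\<close>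

lemma max_face_set_plus:
  assumes "compact S" "compact T" "S \<noteq> {}" "T \<noteq> {}"
  shows "max_face (S + T) c = max_face S c + max_face T c"
proof
  show "max_face (S + T) c \<subseteq> max_face S c + max_face T c"
  proof
    fix z assume "z \<in> max_face (S + T) c"
    then obtain x y where xy: "x \<in> S" "y \<in> T" "z = x + y"
      and z: "\<And>x' y'. x' \<in> S \<Longrightarrow> y' \<in> T \<Longrightarrow> (x' + y') \<bullet> c \<le> (x + y) \<bullet> c"
      by (auto simp: max_face_def set_plus_intro elim: set_plus_elim)
    have "x' \<bullet> c \<le> x \<bullet> c" if "x' \<in> S" for x'
      using z[OF that xy(2)] by (simp add: inner_add_left)
    moreover have "y' \<bullet> c \<le> y \<bullet> c" if "y' \<in> T" for y'
      using z[OF xy(1) that] by (simp add: inner_add_left)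
    ultimately show "z \<in> max_face S c + max_face T c"
      using xy by (auto simp: max_face_def)
  qed
  show "max_face S c + max_face T c \<subseteq> max_face (S + T) c"
  proof
    fix z assume "z \<in> max_face S c + max_face T c"
    then obtain x y where xy: "x \<in> max_face S c" "y \<in> max_face T c" "z = x + y"
      by (blast elim: set_plus_elim)
    have "w \<bullet> c \<le> z \<bullet> c" if w: "w \<in> S + T" for w
    proof -
      obtain x' y' where "x' \<in> S" "y' \<in> T" "w = x' + y'"
        using w by (blast elim: set_plus_elim)
      then show ?thesis
        using xy by (auto simp: max_face_def inner_add_left intro: add_mono)
    qed
    then show "z \<in> max_face (S + T) c"
      using xy by (auto simp: max_face_def)
  qed
qed

text \<open>The right-hand side depends on \<open>c\<close> only through the face of the sum. Hence
  a face of the sum determines its summands, which later gives injectivity.\<close>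

lemma max_face_summand:
  assumes "compact S" "compact T" "S \<noteq> {}" "T \<noteq> {}"
  shows "max_face S c = {x \<in> S. \<exists>y\<in>T. x + y \<in> max_face (S + T) c}"
proof
  show "max_face S c \<subseteq> {x \<in> S. \<exists>y\<in>T. x + y \<in> max_face (S + T) c}"
  proof
    fix x assume x: "x \<in> max_face S c"
    obtain y where y: "y \<in> max_face T c"
      using max_face_nonempty[OF assms(2,4)] by blast
    have "x + y \<in> max_face (S + T) c"
      unfolding max_face_set_plus[OF assms] using x y by (rule set_plus_intro)
    then show "x \<in> {x \<in> S. \<exists>y\<in>T. x + y \<in> max_face (S + T) c}"
      using x y max_face_subset by blast
  qed
  show "{x \<in> S. \<exists>y\<in>T. x + y \<in> max_face (S + T) c} \<subseteq> max_face S c"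
  proof clarify
    fix x y assume xy: "x \<in> S" "y \<in> T" "x + y \<in> max_face (S + T) c"
    have "x' \<bullet> c \<le> x \<bullet> c" if "x' \<in> S" for x'
    proof -
      have "(x' + y) \<bullet> c \<le> (x + y) \<bullet> c"
        using xy that by (auto simp: max_face_def set_plus_intro)
      then show ?thesis by (simp add: inner_add_left)
    qed
    then show "x \<in> max_face S c"
      using xy by (simp add: max_face_def)
  qed
qed

lemma polytope_set_plus:
  fixes S T :: "'a::euclidean_space set"
  assumes "polytope S" "polytope T"
  shows "polytope (S + T)"
proof -
  obtain u v where "finite u" "S = convex hull u" "finite v" "T = convex hull v"
    using assms by (auto simp: polytope_def)
  then show ?thesis
    by (metis convex_hull_set_plus finite_set_plus polytope_convex_hull)
qed

text \<open>With \<open>a\<close> and \<open>b\<close> moved to the origin, the sum has the same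
  span as the union of the two sets, and dimension is additive for orthogonal sets.\<close>

lemma aff_dim_orthogonal_set_plus:
  fixes A B :: "'a::euclidean_space set"
  assumes "a \<in> A" "b \<in> B"
    and orth: "\<And>x y. x \<in> A \<Longrightarrow> y \<in> B \<Longrightarrow> (x - a) \<bullet> (y - b) = 0"
  shows "aff_dim (A + B) = aff_dim A + aff_dim B"
proof -
  let ?A = "(\<lambda>x. x - a) ` A" and ?B = "(\<lambda>x. x - b) ` B" and ?C = "(\<lambda>x. x - (a + b)) ` (A + B)"
  have sub: "?A \<union> ?B \<subseteq> ?C"
  proof (intro Un_least subsetI)
    fix z assume "z \<in> ?A"
    then obtain x where "x \<in> A" "z = (x + b) - (a + b)" by auto
    then show "z \<in> ?C" using assms(2) by blast
  next
    fix z assume "z \<in> ?B"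
    then obtain y where "y \<in> B" "z = (a + y) - (a + b)" by auto
    then show "z \<in> ?C" using assms(1) by blast
  qed
  have "?C \<subseteq> span (?A \<union> ?B)"
  proof
    fix z assume "z \<in> ?C"
    then obtain x y where "x \<in> A" "y \<in> B" "z = (x - a) + (y - b)"
      by (auto elim!: set_plus_elim)
    then show "z \<in> span (?A \<union> ?B)"
      by (simp add: span_add span_base)
  qed
  with sub have "dim ?C = dim (?A \<union> ?B)"
    by (metis dim_span dim_subset order_antisym)
  also have "\<dots> = dim ?A + dim ?B"
    by (rule dim_orthogonal_sum) (use orth in auto)
  finally have "dim ?C = dim ?A + dim ?B" .
  moreover have "a + b \<in> A + B" using assms by blast
  ultimately show ?thesis
    using assms(1,2) by (simp add: aff_dim_eq_dim_subtract[of a] aff_dim_eq_dim_subtract[of b]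
        aff_dim_eq_dim_subtract[of "a + b"] hull_inc)
qed

lemma polytope_rel_interior_face:
  fixes S :: "'a::euclidean_space set"
  assumes "polytope S" "x \<in> S"
  obtains F where "F face_of S" "x \<in> rel_interior F"
proof -
  \<comment> \<open>The smallest face containing \<open>x\<close>: on its relative frontier,
    \<open>x\<close> would lie in a proper face of it, contradicting minimality.\<close>
  define F where "F = \<Inter>{F. F face_of S \<and> x \<in> F}"
  have F: "F face_of S"
    unfolding F_def using assms face_of_refl[OF polytope_imp_convex]
    by (intro face_of_Inter) auto
  have "x \<in> rel_interior F"
  proof (rule ccontr)
    assume "x \<notin> rel_interior F"
    moreover have "x \<in> F" by (auto simp: F_def)
    ultimately have "x \<in> rel_frontier F"
      using closure_subset by (auto simp: rel_frontier_def)
    moreover have "rel_frontier F = \<Union> {G. G face_of F \<and> G \<noteq> F}"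
      by (intro rel_frontier_of_polyhedron_alt polytope_imp_polyhedron
          face_of_polytope_polytope[OF assms(1) F])
    ultimately obtain G where G: "G face_of F" "G \<noteq> F" "x \<in> G" by auto
    have "F \<subseteq> G"
      using face_of_trans[OF G(1) F] G(3) unfolding F_def by blast
    then show False
      using G face_of_imp_subset by blast
  qed
  with F show thesis by (rule that)
qed

section \<open>The dual of a perfectly centered polytope\<close>

text \<open>For a proper nonempty face \<open>F\<close>, this is the conjugate face of the dual
  polytope, written \<open>F\<^sup>D\<close> above.\<close>

definition dual_face :: "'a::euclidean_space set \<Rightarrow> 'a set \<Rightarrow> 'a set" where
  "dual_face P F = {y \<in> dual_body P. \<forall>x\<in>F. x \<bullet> y = 1}"

context
  fixes P :: "'a::euclidean_space set"
  assumes centered: "perfectly_centered P"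
begin

lemma pc_polytope: "polytope P"
  and pc_aff_dim: "aff_dim P = int DIM('a)"
  using centered by (auto simp: perfectly_centered_def)

lemma pc_compact: "compact P" and pc_convex: "convex P"
  using pc_polytope by (auto simp: polytope_imp_compact polytope_imp_convex)

lemma pc_center:
  assumes "F face_of P" "F \<noteq> {}"
  obtains q where "q \<in> rel_interior F" "F = max_face P q"
  using assms centered unfolding perfectly_centered_def outer_normal_cone_def max_face_def by blast

lemma pc_nonempty: "P \<noteq> {}"
  using pc_aff_dim by auto

text \<open>The center \<open>q\<close> of the face \<open>P\<close> has constant inner product with
  all of \<open>P\<close>. For nonzero \<open>q\<close> this would put \<open>P\<close> into a
  hyperplane, against full dimension.\<close>

lemma zero_in_interior: "0 \<in> interior P"
proof -
  obtain q where q: "q \<in> rel_interior P" "P = max_face P q"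
    using pc_center[of P] face_of_refl[OF pc_convex] pc_nonempty by blast
  have eq: "x \<bullet> q = q \<bullet> q" if "x \<in> P" for x
    using q that rel_interior_subset[of P] by (auto simp: max_face_def intro!: antisym)
  have "q = 0"
  proof (rule ccontr)
    assume "q \<noteq> 0"
    moreover have "P \<subseteq> {x. q \<bullet> x = q \<bullet> q}"
      using eq by (auto simp: inner_commute)
    then have "aff_dim P \<le> aff_dim {x. q \<bullet> x = q \<bullet> q}" by (rule aff_dim_subset)
    ultimately have "aff_dim P \<le> int DIM('a) - 1" by simp
    then show False using pc_aff_dim by simp
  qed
  then show ?thesis
    using q(1) rel_interior_interior[of P] aff_dim_eq_full[of P] pc_aff_dim by simp
qed

text \<open>A center lies in the face that it selects, so the maximum it attains over
  \<open>P\<close> is its own square norm.\<close>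

lemma center_inner:
  assumes "q \<in> rel_interior F" "F = max_face P q"
  shows "x \<in> P \<Longrightarrow> x \<bullet> q \<le> q \<bullet> q" and "x \<in> F \<longleftrightarrow> x \<in> P \<and> x \<bullet> q = q \<bullet> q"
proof -
  have q: "q \<in> P" "\<And>y. y \<in> P \<Longrightarrow> y \<bullet> q \<le> q \<bullet> q"
    using assms rel_interior_subset[of F] by (auto simp: max_face_def)
  then show "x \<in> P \<Longrightarrow> x \<bullet> q \<le> q \<bullet> q" by blast
  show "x \<in> F \<longleftrightarrow> x \<in> P \<and> x \<bullet> q = q \<bullet> q"
    unfolding assms(2) max_face_def using q by (auto intro: antisym)
qed

text \<open>Going from the center of \<open>F\<close> through \<open>c\<close>, one leaves \<open>F\<close> in a smaller face, whose points
  are maximized inside \<open>F\<close>; as the center is maximized exactly on \<open>F\<close>, so is \<open>c\<close>.\<close>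

lemma max_face_rel_interior_subset:
  assumes "F face_of P" "c \<in> rel_interior F"
  shows "max_face P c \<subseteq> F"
  using assms
proof (induction "nat (aff_dim F + 1)" arbitrary: F c rule: less_induct)
  case less
  have polyF: "polytope F"
    using face_of_polytope_polytope[OF pc_polytope less.prems(1)] .
  have "F \<noteq> {}" using less.prems(2) by auto
  then obtain q where q: "q \<in> rel_interior F" "F = max_face P q"
    using pc_center less.prems(1) by blast
  show ?case
  proof (cases "c = q")
    case True
    then show ?thesis using q by simp
  next
    case False
    have cF: "c \<in> F" using less.prems(2) rel_interior_subset by blast
    obtain z where z: "z \<in> rel_frontier F" "c \<in> closed_segment q z"
      using segment_to_rel_frontier[OF polytope_imp_convex[OF polyF]
          polytope_imp_bounded[OF polyF] q(1) cF] False by blast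
    then obtain u where u: "0 \<le> u" "u \<le> 1" "c = (1 - u) *\<^sub>R q + u *\<^sub>R z"
      by (auto simp: closed_segment_def)
    have "z \<notin> rel_interior F" using z by (simp add: rel_frontier_def)
    then have "u \<noteq> 1" using u(3) less.prems(2) by auto
    with u have u1: "u < 1" by simp
    have "z \<in> F"
      using z polytope_imp_closed[OF polyF] by (simp add: rel_frontier_def)
    then obtain E where E: "E face_of F" "z \<in> rel_interior E"
      using polytope_rel_interior_face[OF polyF] by blast
    have "E \<noteq> F" using E \<open>z \<notin> rel_interior F\<close> by blast
    then have lt: "aff_dim E < aff_dim F"
      using face_of_aff_dim_lt E(1) polytope_imp_convex[OF polyF] by blast
    have "max_face P z \<subseteq> E"
    proof (rule less.hyps)
      show "nat (aff_dim E + 1) < nat (aff_dim F + 1)"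
        using lt aff_dim_geq[of E] by linarith
    qed (use E face_of_trans less.prems in blast)+
    \<comment> \<open>A comparison point \<open>w\<close> in \<open>F\<close> that is best for
      \<open>z\<close>. A maximizer \<open>x\<close> of \<open>c\<close> is no better for
      \<open>z\<close>, so it must be at least as good as \<open>w\<close> for \<open>q\<close>,
      whose weight \<open>1 - u\<close> is positive; this forces \<open>x\<close> into
      \<open>F\<close>.\<close>
    then obtain w where w: "w \<in> max_face P z" "w \<in> F"
      using max_face_nonempty[OF pc_compact pc_nonempty] face_of_imp_subset[OF E(1)] by blast
    show ?thesis
    proof
      fix x assume x: "x \<in> max_face P c"
      have wP: "w \<in> P" "x \<in> P" using w x by (auto simp: max_face_def)
      have "w \<bullet> c \<le> x \<bullet> c" "x \<bullet> z \<le> w \<bullet> z"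
        using x w wP by (auto simp: max_face_def)
      then have "(1 - u) * (w \<bullet> q) + u * (w \<bullet> z) \<le> (1 - u) * (x \<bullet> q) + u * (w \<bullet> z)"
        using mult_left_mono[OF \<open>x \<bullet> z \<le> w \<bullet> z\<close> u(1)]
        by (simp add: u(3) inner_add_right)
      then have "w \<bullet> q \<le> x \<bullet> q" using u1 by simp
      then show "x \<in> F"
        using center_inner[OF q] w(2) wP by (metis order_antisym)
    qed
  qed
qed

text \<open>Imposing the inequality on finitely many generators of \<open>P\<close> suffices, which
  gives a polyhedron. A ball of radius \<open>e\<close> around 0 inside \<open>P\<close> bounds the
  dual by \<open>1 / e\<close>.\<close>

lemma dual_body_polytope: "polytope (dual_body P)"
proof -
  obtain V where V: "finite V" "P = convex hull V"
    using pc_polytope by (auto simp: polytope_def)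
  have "dual_body P = \<Inter>((\<lambda>v. {x. v \<bullet> x \<le> 1}) ` V)" (is "_ = ?I")
  proof
    show "dual_body P \<subseteq> ?I"
      using hull_subset[of V convex] by (auto simp: dual_body_def V(2) inner_commute)
    show "?I \<subseteq> dual_body P"
    proof
      fix x assume "x \<in> ?I"
      then have "V \<subseteq> {y. x \<bullet> y \<le> 1}" by (auto simp: inner_commute)
      then have "convex hull V \<subseteq> {y. x \<bullet> y \<le> 1}"
        by (simp add: hull_minimal convex_halfspace_le)
      then show "x \<in> dual_body P" by (auto simp: dual_body_def V(2))
    qed
  qed
  then have "polyhedron (dual_body P)"
    using V(1) by (auto intro!: polyhedron_Inter simp: polyhedron_halfspace_le)
  moreover have "bounded (dual_body P)"
  proof -
    obtain e where e: "e > 0" "cball 0 e \<subseteq> P"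
      using zero_in_interior mem_interior_cball by blast
    have "norm y \<le> 1 / e" if "y \<in> dual_body P" for y
    proof (cases "y = 0")
      case False
      have "(e / norm y) *\<^sub>R y \<in> P" using e False by (intro subsetD[OF e(2)]) auto
      then have "y \<bullet> ((e / norm y) *\<^sub>R y) \<le> 1"
        using that by (simp only: dual_body_def) blast
      then have "e * norm y \<le> 1"
        using False by (simp add: dot_square_norm power2_eq_square)
      then show ?thesis using e(1) by (simp add: field_simps)
    qed (use e in auto)
    then show ?thesis by (auto simp: bounded_iff)
  qed
  ultimately show ?thesis by (simp add: polytope_eq_bounded_polyhedron)
qed

lemma dual_body_nonempty: "dual_body P \<noteq> {}"
proof -
  have "0 \<in> dual_body P" by (simp add: dual_body_def)
  then show ?thesis by blast
qed

lemma dual_body_compact: "compact (dual_body P)"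
  using dual_body_polytope by (simp add: polytope_imp_compact)

text \<open>The witness is the center of \<open>F\<close>, inverted in the unit sphere.\<close>

lemma dual_face_center:
  assumes "F face_of P" "F \<noteq> {}" "F \<noteq> P"
  obtains y where "y \<in> dual_face P F" "\<And>x. x \<in> P \<Longrightarrow> x \<bullet> y = 1 \<longleftrightarrow> x \<in> F"
proof -
  obtain q where q: "q \<in> rel_interior F" "F = max_face P q"
    using pc_center assms by blast
  then have "q \<noteq> 0" using assms(3) by auto
  then have qq: "q \<bullet> q > 0" by simp
  let ?y = "(1 / (q \<bullet> q)) *\<^sub>R q"
  have "x \<bullet> ?y \<le> 1" if "x \<in> P" for x
    using center_inner(1)[OF q that] qq by (simp add: field_simps)
  moreover have eq: "x \<bullet> ?y = 1 \<longleftrightarrow> x \<in> F" if "x \<in> P" for x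
    using that \<open>q \<noteq> 0\<close> by (auto simp: center_inner(2)[OF q, of x])
  ultimately have "?y \<in> dual_face P F"
    using face_of_imp_subset[OF assms(1)]
    by (auto simp: dual_face_def dual_body_def inner_commute)
  with eq show thesis using that by blast
qed

text \<open>By \<open>dual_face_center\<close>, some point of the dual face of \<open>A\<close>
  takes the value 1 on \<open>P\<close> only at points of \<open>A\<close>. If it also lies in the
  dual face of \<open>B\<close>, then \<open>B \<subseteq> A\<close>.\<close>

lemma dual_face_inject:
  assumes "F face_of P" "F \<noteq> {}" "F \<noteq> P" "F' face_of P" "F' \<noteq> {}" "F' \<noteq> P"
    and eq: "dual_face P F = dual_face P F'"
  shows "F = F'"
proof -
  have *: "B \<subseteq> A" if A: "A face_of P" "A \<noteq> {}" "A \<noteq> P" "B face_of P"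
    "dual_face P A = dual_face P B" for A B
  proof -
    obtain y where y: "y \<in> dual_face P A" "\<And>x. x \<in> P \<Longrightarrow> x \<bullet> y = 1 \<longleftrightarrow> x \<in> A"
      using dual_face_center[OF A(1-3)] by metis
    have "y \<in> dual_face P B" using y(1) A(5) by simp
    then show ?thesis
      using y(2) face_of_imp_subset[OF A(4)] by (auto simp: dual_face_def)
  qed
  from *[of F F'] *[of F' F] show ?thesis using assms by auto
qed

text \<open>The functional \<open>p\<close> is at most 1 on the dual body, and this value is
  attained because the dual face is nonempty. A point of the dual with value 1 at a relative
  interior point of \<open>F\<close> has value 1 on all of \<open>F\<close>.\<close>

lemma max_face_dual_body:
  assumes "F face_of P" "F \<noteq> P" "p \<in> rel_interior F"
  shows "max_face (dual_body P) p = dual_face P F"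
proof
  have "F \<noteq> {}" using assms(3) by auto
  then obtain y0 where y0: "y0 \<in> dual_face P F"
    using dual_face_center assms by blast
  have pF: "p \<in> F" using assms(3) rel_interior_subset by blast
  have FP: "F \<subseteq> P" using assms(1) by (rule face_of_imp_subset)
  have y0p: "y0 \<in> dual_body P" "y0 \<bullet> p = 1"
    using y0 pF by (auto simp: dual_face_def inner_commute)
  have le1: "y \<bullet> x \<le> 1" if "y \<in> dual_body P" "x \<in> F" for x y
    using that FP by (auto simp: dual_body_def)
  show "dual_face P F \<subseteq> max_face (dual_body P) p"
    using le1 pF by (auto simp: dual_face_def max_face_def inner_commute)
  show "max_face (dual_body P) p \<subseteq> dual_face P F"
  proof
    fix y assume y: "y \<in> max_face (dual_body P) p"
    then have yd: "y \<in> dual_body P" and "y0 \<bullet> p \<le> y \<bullet> p"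
      using y0p by (auto simp: max_face_def)
    then have yp: "y \<bullet> p = 1" using le1[OF yd pF] y0p by simp
    have "x \<bullet> y = 1" if "x \<in> F" for x
    proof -
      \<comment> \<open>The segment from \<open>x\<close> to \<open>p\<close> is prolonged beyond
        \<open>p\<close> inside \<open>F\<close>. If \<open>y\<close> were below 1 at
        \<open>x\<close>, it would exceed 1 at the far end.\<close>
      obtain m where m: "m > 1" "(1 - m) *\<^sub>R x + m *\<^sub>R p \<in> F"
        using convex_rel_interior_if[OF face_of_imp_convex[OF assms(1)] assms(3)]
          hull_inc[OF \<open>x \<in> F\<close>] by (meson order_refl)
      have "(1 - m) * (y \<bullet> x) + m \<le> 1"
        using le1[OF yd m(2)] yp by (simp add: inner_add_right)
      then have "(m - 1) * 1 \<le> (m - 1) * (y \<bullet> x)" by (simp add: algebra_simps)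
      then have "1 \<le> y \<bullet> x" using m(1) by (simp only: mult_le_cancel_left_pos)
      then show ?thesis using le1[OF yd that] by (simp add: inner_commute)
    qed
    then show "y \<in> dual_face P F" using yd by (simp add: dual_face_def)
  qed
qed

text \<open>The dual face has the dimension of the affine space \<open>L\<close>, a translate of the
  orthogonal complement \<open>W\<close> of \<open>span F\<close>. The missing 1 comes from
  \<open>dim F = aff_dim F + 1\<close>.\<close>

lemma aff_dim_dual_face:
  assumes "F face_of P" "F \<noteq> {}" "F \<noteq> P"
  shows "aff_dim F + aff_dim (dual_face P F) = int DIM('a) - 1"
proof -
  obtain y0 where y0: "y0 \<in> dual_face P F" "\<And>x. x \<in> P \<Longrightarrow> x \<bullet> y0 = 1 \<longleftrightarrow> x \<in> F"
    using dual_face_center[OF assms] by blast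
  define W where "W = {z::'a. \<forall>x\<in>F. x \<bullet> z = 0}"
  define L where "L = {y::'a. \<forall>x\<in>F. x \<bullet> y = 1}"
  have y0L: "y0 \<in> L" using y0(1) by (simp add: dual_face_def L_def)
  obtain V where V: "finite V" "P = convex hull V"
    using pc_polytope by (auto simp: polytope_def)
  \<comment> \<open>Generators outside \<open>F\<close> satisfy their inequality strictly at
    \<open>y0\<close>, hence in the open set \<open>T\<close> around it; generators in
    \<open>F\<close> give equality on \<open>L\<close>. So \<open>L \<inter> T\<close> lies in the
    dual face.\<close>
  define T where "T = (\<Inter>v\<in>V - F. {y. v \<bullet> y < 1})"
  have "open T"
    unfolding T_def using V(1) by (intro open_INT) (auto simp: open_halfspace_lt)
  have VP: "V \<subseteq> P" unfolding V(2) by (rule hull_subset)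
  have "v \<bullet> y0 < 1" if "v \<in> V - F" for v
  proof -
    have "v \<bullet> y0 \<le> 1"
      using y0(1) that VP by (auto simp: dual_face_def dual_body_def inner_commute)
    moreover have "v \<bullet> y0 \<noteq> 1" using y0(2)[of v] that VP by blast
    ultimately show ?thesis by simp
  qed
  then have y0T: "y0 \<in> T" by (auto simp: T_def)
  have "L \<inter> T \<subseteq> dual_face P F"
  proof
    fix y assume y: "y \<in> L \<inter> T"
    have "v \<bullet> y \<le> 1" if "v \<in> V" for v
      using y that by (cases "v \<in> F") (auto simp: L_def T_def less_imp_le)
    then have "V \<subseteq> {x. y \<bullet> x \<le> 1}" by (auto simp: inner_commute)
    then have "convex hull V \<subseteq> {x. y \<bullet> x \<le> 1}"
      by (simp add: hull_minimal convex_halfspace_le)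
    then show "y \<in> dual_face P F" using y by (auto simp: dual_face_def dual_body_def V(2) L_def)
  qed
  moreover have "dual_face P F \<subseteq> L" by (auto simp: dual_face_def L_def)
  moreover have LW: "L = (\<lambda>z. y0 + z) ` W"
  proof
    show "L \<subseteq> (\<lambda>z. y0 + z) ` W"
    proof
      fix y assume "y \<in> L"
      then have "y - y0 \<in> W" using y0L by (auto simp: L_def W_def inner_diff_right)
      then show "y \<in> (\<lambda>z. y0 + z) ` W" by (metis add_diff_cancel_left' image_iff diff_add_cancel add.commute)
    qed
    show "(\<lambda>z. y0 + z) ` W \<subseteq> L" using y0L by (auto simp: L_def W_def inner_add_right)
  qed
  have "subspace W" by (auto simp: W_def subspace_def inner_add_right)
  then have "convex L" unfolding LW by (simp add: convex_translation subspace_imp_convex)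
  then have "aff_dim (L \<inter> T) = aff_dim L"
    using aff_dim_convex_Int_open \<open>open T\<close> y0L y0T by blast
  ultimately have "aff_dim (dual_face P F) = aff_dim L"
    by (metis aff_dim_subset order_antisym)
  also have "\<dots> = aff_dim W" unfolding LW by (rule aff_dim_translation_eq)
  also have "\<dots> = int (dim W)" using \<open>subspace W\<close> by (rule aff_dim_subspace)
  finally have 1: "aff_dim (dual_face P F) = int (dim W)" .
  have "W = {y \<in> UNIV. \<forall>x\<in>span F. orthogonal x y}"
  proof -
    have "x \<bullet> z = 0" if "z \<in> W" "x \<in> span F" for x z
      using that(2) by (induction rule: span_induct)
        (use that(1) in \<open>auto simp: W_def subspace_def inner_add_left\<close>)
    then show ?thesis by (auto simp: W_def orthogonal_def span_base)
  qed
  then have 2: "dim W + dim F = DIM('a)"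
    using dim_subspace_orthogonal_to_vectors[of "span F" "UNIV :: 'a set"] by simp
  \<comment> \<open>A hyperplane missing the origin contains \<open>F\<close>, so adjoining 0 raises
    the affine dimension by one.\<close>
  have "affine hull F \<subseteq> {x. y0 \<bullet> x = 1}"
  proof (intro hull_minimal affine_hyperplane)
    show "F \<subseteq> {x. y0 \<bullet> x = 1}" using y0L by (auto simp: L_def inner_commute)
  qed
  then have "0 \<notin> affine hull F" by auto
  then have "aff_dim F + 1 = aff_dim (insert 0 F)" by (simp add: aff_dim_insert)
  also have "\<dots> = int (dim F)" by (metis aff_dim_zero dim_span hull_inc insertI1 span_insert_0)
  finally show ?thesis using 1 2 by linarith
qed

section \<open>Proper faces of the sum as flags\<close>

lemma flag_normal_vector:
  assumes "G face_of P" "G \<noteq> {}" "F face_of P" "F \<noteq> P" "G \<subseteq> F"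
  obtains c where "max_face P c = G" "max_face (dual_body P) c = dual_face P F"
proof -
  obtain g where g: "g \<in> rel_interior G" "G = max_face P g"
    using pc_center assms by blast
  have "F \<noteq> {}" using assms by blast
  then obtain q where q: "q \<in> rel_interior F" "F = max_face P q"
    using pc_center assms by blast
  \<comment> \<open>The midpoint of \<open>g\<close> in \<open>F\<close> and \<open>q\<close> in the
    relative interior of \<open>F\<close> is again in that relative interior, which fixes its
    maximizers on the dual. Over \<open>P\<close>, both summands attain their maximum on
    \<open>G\<close>, and \<open>g\<close> only there.\<close>
  define c where "c = (1/2) *\<^sub>R (g + q)"
  have "g \<in> F" using g(1) rel_interior_subset assms(5) by blast
  then have "g - (1/2) *\<^sub>R (g - q) \<in> rel_interior F"
    using rel_interior_convex_shrink[OF face_of_imp_convex[OF assms(3)] q(1)] by simp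
  moreover have "g - (1/2) *\<^sub>R (g - q) = c"
    unfolding c_def by (simp add: algebra_simps flip: scaleR_left_distrib)
  ultimately have "c \<in> rel_interior F" by simp
  then have 1: "max_face (dual_body P) c = dual_face P F"
    using max_face_dual_body assms by blast
  obtain w where w: "w \<in> G" using assms(2) by blast
  have wm: "w \<in> P" "\<And>y. y \<in> P \<Longrightarrow> y \<bullet> g \<le> w \<bullet> g" "\<And>y. y \<in> P \<Longrightarrow> y \<bullet> q \<le> w \<bullet> q"
    using w assms(5) g(2) q(2) by (auto simp: max_face_def)
  have "max_face P c = G"
  proof
    show "max_face P c \<subseteq> G"
    proof
      fix x assume x: "x \<in> max_face P c"
      then have xP: "x \<in> P" and "w \<bullet> c \<le> x \<bullet> c" using wm by (auto simp: max_face_def)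
      then have "w \<bullet> g + w \<bullet> q \<le> x \<bullet> g + x \<bullet> q"
        by (simp add: c_def inner_add_right)
      then have "w \<bullet> g \<le> x \<bullet> g" using wm(3)[OF xP] by simp
      then have "\<forall>y\<in>P. y \<bullet> g \<le> x \<bullet> g" using wm(2) order_trans by blast
      then show "x \<in> G" using xP by (subst g(2)) (simp add: max_face_def)
    qed
    show "G \<subseteq> max_face P c"
    proof
      fix x assume x: "x \<in> G"
      then have "x \<in> max_face P g" "x \<in> max_face P q" using g(2) q(2) assms(5) by auto
      then show "x \<in> max_face P c"
        by (auto simp: max_face_def c_def inner_add_right intro: add_mono)
    qed
  qed
  then show thesis using 1 that by blast
qed

lemma normal_vector_flag:
  assumes "c \<noteq> 0"
  obtains F where "F face_of P" "F \<noteq> P" "max_face P c \<subseteq> F"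
    "max_face (dual_body P) c = dual_face P F"
proof -
  \<comment> \<open>Rescaling \<open>c\<close> to the boundary of \<open>P\<close> keeps its
    maximizers. The face with the rescaled point in its relative interior is proper and serves as
    \<open>F\<close>.\<close>
  obtain r where r: "r > 0" "0 + r *\<^sub>R c \<in> frontier P"
    using ray_to_frontier[OF polytope_imp_bounded[OF pc_polytope] zero_in_interior assms] by blast
  define p where "p = r *\<^sub>R c"
  have p: "p \<in> P" "p \<notin> interior P"
    using r(2) pc_compact by (auto simp: p_def frontier_def compact_imp_closed)
  obtain F where F: "F face_of P" "p \<in> rel_interior F"
    using polytope_rel_interior_face[OF pc_polytope p(1)] by blast
  have "F \<noteq> P"
  proof
    assume "F = P"
    then show False
      using F(2) p(2) rel_interior_interior[of P] aff_dim_eq_full[of P] pc_aff_dim by simp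
  qed
  then show thesis
    using that[OF F(1)] max_face_rel_interior_subset[OF F] max_face_dual_body[OF F(1) _ F(2)]
    by (simp add: p_def max_face_scaleR[OF r(1)])
qed

text \<open>Because \<open>G \<subseteq> F\<close>, every inner product between \<open>G\<close> and
  the dual face equals 1, so differences taken within the two sets are orthogonal.\<close>

lemma aff_dim_flag_face:
  assumes "G face_of P" "G \<noteq> {}" "F face_of P" "F \<noteq> P" "G \<subseteq> F"
  shows "aff_dim (G + dual_face P F) = aff_dim G + (int DIM('a) - 1 - aff_dim F)"
proof -
  have "F \<noteq> {}" using assms by blast
  then obtain y where y: "y \<in> dual_face P F"
    using dual_face_center assms by blast
  obtain g where g: "g \<in> G" using assms(2) by blast
  have "aff_dim (G + dual_face P F) = aff_dim G + aff_dim (dual_face P F)"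
    by (rule aff_dim_orthogonal_set_plus[OF g y])
      (use g y subsetD[OF assms(5)] in \<open>simp_all add: dual_face_def inner_diff_left inner_diff_right\<close>)
  then show ?thesis using aff_dim_dual_face[OF assms(3) \<open>F \<noteq> {}\<close> assms(4)] by linarith
qed

lemma bij_betw_flags_faces:
  "bij_betw (\<lambda>(G, F). G + dual_face P F)
     {(G, F). G face_of P \<and> G \<noteq> {} \<and> F face_of P \<and> F \<noteq> P \<and> G \<subseteq> F}
     {H. H face_of P + dual_body P \<and> H \<noteq> {} \<and> H \<noteq> P + dual_body P}"
  (is "bij_betw ?f ?A ?B")
proof -
  note sum = max_face_set_plus[OF pc_compact dual_body_compact pc_nonempty dual_body_nonempty]
  note left = max_face_summand[OF pc_compact dual_body_compact pc_nonempty dual_body_nonempty]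
  note right = max_face_summand[OF dual_body_compact pc_compact dual_body_nonempty pc_nonempty]
  have poly: "polytope (P + dual_body P)"
    using pc_polytope dual_body_polytope by (rule polytope_set_plus)
  have "inj_on ?f ?A"
  proof (rule inj_onI, clarify)
    fix G F G' F'
    assume A: "G face_of P" "G \<noteq> {}" "F face_of P" "F \<noteq> P" "G \<subseteq> F"
      and A': "G' face_of P" "G' \<noteq> {}" "F' face_of P" "F' \<noteq> P" "G' \<subseteq> F'"
      and eq: "G + dual_face P F = G' + dual_face P F'"
    obtain c where c: "max_face P c = G" "max_face (dual_body P) c = dual_face P F"
      by (rule flag_normal_vector[OF A])
    obtain c' where c': "max_face P c' = G'" "max_face (dual_body P) c' = dual_face P F'"
      by (rule flag_normal_vector[OF A'])
    \<comment> \<open>Normal vectors selecting the same face of the sum select the same faces of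
      \<open>P\<close> and of the dual, by \<open>max_face_summand\<close>.\<close>
    have same: "max_face (P + dual_body P) c = max_face (P + dual_body P) c'"
      unfolding sum c c' by (rule eq)
    have "max_face P c = max_face P c'"
      unfolding left[of c] left[of c'] same ..
    then have "G = G'" unfolding c c' .
    moreover have "max_face (dual_body P) c = max_face (dual_body P) c'"
      unfolding right[of c] right[of c'] add.commute[of "dual_body P" P] same ..
    then have "dual_face P F = dual_face P F'" unfolding c c' .
    then have "F = F'"
      by (rule dual_face_inject[rotated -1]) (use A A' in blast)+
    ultimately show "G = G' \<and> F = F'" by blast
  qed
  moreover have "?f ` ?A \<subseteq> ?B"
  proof (rule image_subsetI)
    fix x assume "x \<in> ?A"
    then obtain G F where x: "x = (G, F)"
      and A: "G face_of P" "G \<noteq> {}" "F face_of P" "F \<noteq> P" "G \<subseteq> F"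
      by auto
    obtain c where c: "max_face P c = G" "max_face (dual_body P) c = dual_face P F"
      by (rule flag_normal_vector[OF A])
    let ?H = "G + dual_face P F"
    have H: "?H = max_face (P + dual_body P) c" by (simp add: sum c)
    have "?H face_of P + dual_body P"
      unfolding H by (intro max_face_face_of polytope_imp_convex poly)
    moreover have "?H \<noteq> {}"
      unfolding H using pc_nonempty dual_body_nonempty polytope_imp_compact[OF poly]
      by (intro max_face_nonempty) auto
    moreover have "?H \<noteq> P + dual_body P"
    proof
      assume "?H = P + dual_body P"
      then have all: "max_face (P + dual_body P) c = P + dual_body P" using H by simp
      obtain y where y: "y \<in> dual_body P" using dual_body_nonempty by blast
      \<comment> \<open>If \<open>c\<close> were constant on the sum, it would be constant on
        \<open>P\<close>, making \<open>G\<close>, and with it \<open>F\<close>, all of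
        \<open>P\<close>.\<close>
      have "P \<subseteq> max_face P c"
        unfolding left[of c] all using y set_plus_intro by blast
      then have "P \<subseteq> F" using c(1) A(5) by simp
      then show False using A(3,4) face_of_imp_subset by blast
    qed
    ultimately show "?f x \<in> ?B" by (simp add: x)
  qed
  moreover have "?B \<subseteq> ?f ` ?A"
  proof
    fix H assume "H \<in> ?B"
    then have H: "H face_of P + dual_body P" "H \<noteq> {}" "H \<noteq> P + dual_body P"
      by auto
    obtain c where c: "H = max_face (P + dual_body P) c"
      by (rule face_of_polytope_eq_max_face[OF poly H(1,2)])
    have "c \<noteq> 0" using c H(3) by auto
    then obtain F where F: "F face_of P" "F \<noteq> P" "max_face P c \<subseteq> F"
      "max_face (dual_body P) c = dual_face P F"
      by (rule normal_vector_flag)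
    have "(max_face P c, F) \<in> ?A"
      using F max_face_face_of[OF pc_convex, of c] max_face_nonempty[OF pc_compact pc_nonempty, of c]
      by simp
    moreover have "H = ?f (max_face P c, F)" using c F(4) by (simp add: sum)
    ultimately show "H \<in> ?f ` ?A" by (rule rev_image_eqI)
  qed
  ultimately show ?thesis unfolding bij_betw_def by (intro conjI equalityI)
qed

end

text \<open>The numerical condition says that the dimension computed in
  \<open>aff_dim_flag_face\<close> is \<open>k\<close>.\<close>

definition flags :: "nat \<Rightarrow> 'a::euclidean_space set \<Rightarrow> ('a set \<times> 'a set) set" where
  "flags k S = {(G, F). G face_of S \<and> G \<noteq> {} \<and> F face_of S \<and> F \<noteq> S \<and> G \<subseteq> F \<and>
     aff_dim G + int DIM('a) = aff_dim F + 1 + int k}"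

lemma face_number_sum_dual:
  fixes P :: "'a::euclidean_space set"
  assumes "perfectly_centered P" "k < DIM('a)"
  shows "face_number k (P + dual_body P) = card (flags k P)"
proof -
  let ?Q = "P + dual_body P" and ?f = "\<lambda>(G, F). G + dual_face P F"
  let ?A = "{(G, F). G face_of P \<and> G \<noteq> {} \<and> F face_of P \<and> F \<noteq> P \<and> G \<subseteq> F}"
  note bij = bij_betw_flags_faces[OF assms(1)]
  \<comment> \<open>The sum contains \<open>P\<close> and so has dimension above \<open>k\<close>.
    Every \<open>k\<close>-face is therefore proper and covered by the bijection with flags.\<close>
  have "P + {0} \<subseteq> ?Q"
    by (intro set_plus_mono2) (auto simp: dual_body_def)
  then have "aff_dim P \<le> aff_dim ?Q" by (intro aff_dim_subset) (simp add: set_plus_def)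
  then have full: "aff_dim ?Q \<noteq> int k"
    using pc_aff_dim[OF assms(1)] assms(2) by linarith
  have image: "?f ` flags k P = {F. F face_of ?Q \<and> aff_dim F = int k}"
  proof (intro equalityI subsetI)
    fix H assume "H \<in> ?f ` flags k P"
    then obtain G F where GF: "(G, F) \<in> flags k P" "H = G + dual_face P F" by auto
    have "H \<in> ?f ` ?A"
      by (rule rev_image_eqI[of "(G, F)"]) (use GF in \<open>auto simp: flags_def\<close>)
    then have "H face_of ?Q" using bij by (simp add: bij_betw_def)
    moreover have "aff_dim H = int k"
      using GF aff_dim_flag_face[OF assms(1), of G F] by (auto simp: flags_def)
    ultimately show "H \<in> {F. F face_of ?Q \<and> aff_dim F = int k}" by blast
  next
    fix H assume "H \<in> {F. F face_of ?Q \<and> aff_dim F = int k}"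
    then have H: "H face_of ?Q" "aff_dim H = int k" by auto
    then have "H \<noteq> {}" "H \<noteq> ?Q" using full by auto
    then have "H \<in> ?f ` ?A" using bij H by (simp add: bij_betw_def)
    then obtain G F where GF: "(G, F) \<in> ?A" "H = G + dual_face P F" by auto
    then have "(G, F) \<in> flags k P"
      using aff_dim_flag_face[OF assms(1), of G F] H(2) by (auto simp: flags_def)
    then show "H \<in> ?f ` flags k P" using GF(2) by (auto intro: rev_image_eqI)
  qed
  have inj: "inj_on ?f (flags k P)"
    using bij_betw_imp_inj_on[OF bij] by (rule inj_on_subset) (auto simp: flags_def)
  show ?thesis
    unfolding face_number_def image[symmetric] using inj by (rule card_image)
qed

section \<open>Combinatorial invariance\<close>

text \<open>Every face has a facet, so a strictly monotone map of face lattices cannot lower dimensions.\<close>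

lemma aff_dim_le_face_embedding:
  fixes P :: "'a::euclidean_space set" and Q :: "'b::euclidean_space set"
  assumes "polytope P"
    and maps: "\<And>F. F face_of P \<Longrightarrow> \<phi> F face_of Q"
    and emb: "\<And>F F'. F face_of P \<Longrightarrow> F' face_of P \<Longrightarrow> F \<subseteq> F' \<longleftrightarrow> \<phi> F \<subseteq> \<phi> F'"
    and "F face_of P"
  shows "aff_dim F \<le> aff_dim (\<phi> F)"
  using assms(4)
\<comment> \<open>The shift by 1 separates the empty face, of dimension -1, from the
  vertices.\<close>
proof (induction "nat (aff_dim F + 1)" arbitrary: F rule: less_induct)
  case less
  show ?case
  proof (cases "F = {}")
    case True
    then show ?thesis using aff_dim_geq[of "\<phi> F"] by simp
  next
    case False
    obtain E where E: "E face_of F" "aff_dim E = aff_dim F - 1"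
    proof (cases "aff_dim F > 0")
      case True
      then show thesis
        using polytope_facet_exists face_of_polytope_polytope[OF assms(1) less.prems] that
        by (metis facet_of_def)
    next
      \<comment> \<open>The facet of a single point is the empty face.\<close>
      case False
      then have "aff_dim F = 0"
        using \<open>F \<noteq> {}\<close> aff_dim_geq[of F] aff_dim_empty[of F] by linarith
      then show thesis using that[of "{}"] by simp
    qed
    have EP: "E face_of P" using E(1) less.prems by (rule face_of_trans)
    have "aff_dim E \<le> aff_dim (\<phi> E)"
      using less.hyps[OF _ EP] E(2) aff_dim_geq[of E] by simp
    moreover have "aff_dim (\<phi> E) < aff_dim (\<phi> F)"
    proof (rule face_of_aff_dim_lt)
      show "convex (\<phi> F)" using maps[OF less.prems] face_of_imp_convex by blast
      have "\<phi> E \<subseteq> \<phi> F" using emb[OF EP less.prems] face_of_imp_subset[OF E(1)] by blast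
      then show "\<phi> E face_of \<phi> F"
        using face_of_face maps EP less.prems by blast
      show "\<phi> E \<noteq> \<phi> F"
      proof
        assume "\<phi> E = \<phi> F"
        then have "F \<subseteq> E" using emb[OF less.prems EP] by simp
        then show False using E face_of_imp_subset by force
      qed
    qed
    ultimately show ?thesis using E(2) by linarith
  qed
qed

text \<open>The dimension bound applied to the isomorphism and to its inverse shows that dimensions
  are preserved. Emptiness is read off from dimension -1, and \<open>P\<close> goes to
  \<open>Q\<close> as the largest face, so flags go to flags.\<close>

lemma card_flags_combinatorially_equivalent:
  fixes P Q :: "'a::euclidean_space set"
  assumes "polytope P" "polytope Q" "combinatorially_equivalent P Q"
  shows "card (flags k P) = card (flags k Q)"
proof -
  let ?FP = "{F. F face_of P}" and ?FQ = "{G. G face_of Q}"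
  obtain \<phi> where bij: "bij_betw \<phi> ?FP ?FQ"
    and emb: "\<And>F F'. F face_of P \<Longrightarrow> F' face_of P \<Longrightarrow> F \<subseteq> F' \<longleftrightarrow> \<phi> F \<subseteq> \<phi> F'"
    using assms(3) unfolding combinatorially_equivalent_def by blast
  define \<psi> where "\<psi> = the_inv_into ?FP \<phi>"
  have maps: "\<phi> F face_of Q" if "F face_of P" for F
    using bij that by (auto simp: bij_betw_def)
  have \<psi>maps: "\<psi> G face_of P" if "G face_of Q" for G
    using bij_betw_the_inv_into[OF bij] that by (auto simp: bij_betw_def \<psi>_def)
  have \<phi>\<psi>: "\<phi> (\<psi> G) = G" if "G face_of Q" for G
    using f_the_inv_into_f_bij_betw[OF bij] that by (simp add: \<psi>_def)
  have \<psi>\<phi>: "\<psi> (\<phi> F) = F" if "F face_of P" for F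
    using the_inv_into_f_f[OF bij_betw_imp_inj_on[OF bij]] that by (simp add: \<psi>_def)
  have dim: "aff_dim (\<phi> F) = aff_dim F" if "F face_of P" for F
  proof (rule antisym)
    have "aff_dim (\<phi> F) \<le> aff_dim (\<psi> (\<phi> F))"
      by (rule aff_dim_le_face_embedding[OF assms(2) \<psi>maps])
        (use emb \<psi>maps \<phi>\<psi> maps that in auto)
    then show "aff_dim (\<phi> F) \<le> aff_dim F" by (simp add: \<psi>\<phi> that)
    show "aff_dim F \<le> aff_dim (\<phi> F)"
      by (rule aff_dim_le_face_embedding[OF assms(1) maps emb that])
  qed
  have empty: "\<phi> F = {} \<longleftrightarrow> F = {}" if "F face_of P" for F
    using dim[OF that] by (metis aff_dim_empty)
  have PP: "P face_of P" and QQ: "Q face_of Q"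
    using assms polytope_imp_convex face_of_refl by blast+
  have "\<phi> P = Q"
    using emb[OF \<psi>maps[OF QQ] PP] \<phi>\<psi>[OF QQ] face_of_imp_subset[OF \<psi>maps[OF QQ]]
      face_of_imp_subset[OF maps[OF PP]] by auto
  then have whole: "\<phi> F = Q \<longleftrightarrow> F = P" if "F face_of P" for F
    using \<psi>\<phi> that PP by metis
  have "flags k Q = map_prod \<phi> \<phi> ` flags k P"
  proof (intro equalityI subsetI)
    fix x assume "x \<in> flags k Q"
    then obtain G F where x: "x = (G, F)" and GF: "(G, F) \<in> flags k Q" by (cases x) auto
    then have "G face_of Q" "F face_of Q" by (auto simp: flags_def)
    note f = \<psi>maps[OF this(1)] \<psi>maps[OF this(2)] \<phi>\<psi>[OF this(1)] \<phi>\<psi>[OF this(2)]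
    have "(\<psi> G, \<psi> F) \<in> flags k P"
      using GF f empty[OF f(1)] whole[OF f(2)] emb[OF f(1,2)] dim[OF f(1)] dim[OF f(2)]
      by (simp add: flags_def)
    moreover have "x = map_prod \<phi> \<phi> (\<psi> G, \<psi> F)" using x f by simp
    ultimately show "x \<in> map_prod \<phi> \<phi> ` flags k P" by (rule rev_image_eqI)
  next
    fix x assume "x \<in> map_prod \<phi> \<phi> ` flags k P"
    then obtain G F where x: "x = (\<phi> G, \<phi> F)" "(G, F) \<in> flags k P" by auto
    then have "G face_of P" "F face_of P" by (auto simp: flags_def)
    then show "x \<in> flags k Q"
      using x maps empty whole dim emb[of G F] by (simp add: flags_def)
  qed
  moreover have "inj_on (map_prod \<phi> \<phi>) (flags k P)"
    by (rule inj_onI) (use \<psi>\<phi> in \<open>auto simp: flags_def\<close>, (metis \<psi>\<phi>)+)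
  ultimately show ?thesis by (simp add: card_image)
qed

section \<open>Flags of the standard cube\<close>

text \<open>These index the nonempty faces of the cube: a zero marks a free coordinate, a nonzero
  entry the side to which a coordinate is fixed. The vector itself is the center of its
  face.\<close>

definition sign_vectors :: "(real ^ 'n) set" where
  "sign_vectors = {s. \<forall>i. s $ i \<in> {-1, 0, 1}}"

definition cube_face :: "real ^ 'n \<Rightarrow> (real ^ 'n) set" where
  "cube_face s = {x. \<forall>i. if s $ i = 0 then \<bar>x $ i\<bar> \<le> 1 else x $ i = s $ i}"

lemma cube_face_0: "cube_face 0 = cbox (- One) One"
  by (auto simp: cube_face_def mem_box_cart cart_eq_inner_axis axis_in_Basis_iff abs_le_iff
      minus_le_iff)

lemma sign_vector_in_cube_face: "s \<in> sign_vectors \<Longrightarrow> s \<in> cube_face s"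
  by (simp add: cube_face_def)

lemma cube_face_subset_iff:
  assumes "s \<in> sign_vectors" "t \<in> sign_vectors"
  shows "cube_face s \<subseteq> cube_face t \<longleftrightarrow> (\<forall>i. t $ i \<noteq> 0 \<longrightarrow> s $ i = t $ i)"
proof
  assume "cube_face s \<subseteq> cube_face t"
  then have "s \<in> cube_face t" using sign_vector_in_cube_face assms by blast
  then show "\<forall>i. t $ i \<noteq> 0 \<longrightarrow> s $ i = t $ i" by (auto simp: cube_face_def)
next
  assume *: "\<forall>i. t $ i \<noteq> 0 \<longrightarrow> s $ i = t $ i"
  show "cube_face s \<subseteq> cube_face t"
  proof
    fix x assume x: "x \<in> cube_face s"
    have "if t $ i = 0 then \<bar>x $ i\<bar> \<le> 1 else x $ i = t $ i" for i
    proof -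
      have "s $ i \<in> {-1, 0, 1}" using assms(1) by (simp add: sign_vectors_def)
      moreover have "if s $ i = 0 then \<bar>x $ i\<bar> \<le> 1 else x $ i = s $ i"
        using x by (simp add: cube_face_def)
      ultimately show ?thesis using * by (auto split: if_splits)
    qed
    then show "x \<in> cube_face t" by (simp add: cube_face_def)
  qed
qed

lemma inj_on_cube_face: "inj_on cube_face (sign_vectors :: (real ^ 'n) set)"
proof (rule inj_onI)
  fix s t :: "real ^ 'n"
  assume "s \<in> sign_vectors" "t \<in> sign_vectors" "cube_face s = cube_face t"
  then have "\<forall>i. t $ i \<noteq> 0 \<longrightarrow> s $ i = t $ i" "\<forall>i. s $ i \<noteq> 0 \<longrightarrow> t $ i = s $ i"
    using cube_face_subset_iff by blast+
  then show "s = t" unfolding vec_eq_iff by metis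
qed

text \<open>Coordinates are maximized independently: \<open>y $ i * c $ i\<close> is at most
  \<open>\<bar>c $ i\<bar>\<close>, and where \<open>c $ i\<close> is nonzero, equality holds only
  for \<open>y $ i = sgn (c $ i)\<close>.\<close>

lemma max_face_cube:
  "max_face (cube_face 0) c = cube_face (\<chi> i. sgn (c $ i))" for c :: "real ^ 'n"
proof -
  let ?s = "(\<chi> i. sgn (c $ i)) :: real ^ 'n"
  have le: "y $ i * c $ i \<le> \<bar>c $ i\<bar>" if "y \<in> cube_face 0" for y :: "real ^ 'n" and i
  proof -
    have "\<bar>y $ i\<bar> \<le> 1" using that by (simp add: cube_face_def)
    then have "\<bar>y $ i\<bar> * \<bar>c $ i\<bar> \<le> 1 * \<bar>c $ i\<bar>" by (intro mult_right_mono) auto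
    then show ?thesis by (metis abs_mult abs_le_D1 mult_1)
  qed
  have sub: "x \<in> cube_face 0" and eq: "x \<bullet> c = (\<Sum>i\<in>UNIV. \<bar>c $ i\<bar>)" if "x \<in> cube_face ?s" for x
  proof -
    have x: "if c $ i = 0 then \<bar>x $ i\<bar> \<le> 1 else x $ i = sgn (c $ i)" for i
      using that by (simp add: cube_face_def sgn_zero_iff)
    have "\<bar>x $ i\<bar> \<le> 1" for i using x[of i] by (auto split: if_splits simp: abs_sgn_eq)
    then show "x \<in> cube_face 0" by (simp add: cube_face_def)
    have "x $ i * c $ i = \<bar>c $ i\<bar>" for i
      using x[of i] by (auto split: if_splits simp: mult.commute abs_sgn)
    then show "x \<bullet> c = (\<Sum>i\<in>UNIV. \<bar>c $ i\<bar>)" by (simp add: inner_vec_def)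
  qed
  show ?thesis
  proof
    show "cube_face ?s \<subseteq> max_face (cube_face 0) c"
    proof
      fix x assume x: "x \<in> cube_face ?s"
      have "y \<bullet> c \<le> x \<bullet> c" if "y \<in> cube_face 0" for y
        unfolding eq[OF x] by (simp add: inner_vec_def sum_mono le[OF that])
      then show "x \<in> max_face (cube_face 0) c" using sub[OF x] by (simp add: max_face_def)
    qed
    show "max_face (cube_face 0) c \<subseteq> cube_face ?s"
    proof
      fix x assume x: "x \<in> max_face (cube_face 0) c"
      then have x0: "x \<in> cube_face 0" by (simp add: max_face_def)
      have s: "?s \<in> cube_face ?s" by (simp add: cube_face_def)
      have "?s \<bullet> c \<le> x \<bullet> c" using x sub[OF s] unfolding max_face_def by blast
      \<comment> \<open>Equality of the sums, together with the termwise bound, forces equality in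
        every coordinate.\<close>
      then have "(\<Sum>i\<in>UNIV. x $ i * c $ i) = (\<Sum>i\<in>UNIV. \<bar>c $ i\<bar>)"
        using sum_mono[of UNIV "\<lambda>i. x $ i * c $ i" "\<lambda>i. \<bar>c $ i\<bar>"] le[OF x0]
        unfolding eq[OF s] by (simp add: inner_vec_def)
      then have "x $ i * c $ i = \<bar>c $ i\<bar>" for i
        by (rule sum_mono_inv) (use le[OF x0] in auto)
      then have "x $ i = sgn (c $ i)" if "c $ i \<noteq> 0" for i
        using that by (metis abs_sgn mult.commute mult_cancel_right)
      moreover have "\<bar>x $ i\<bar> \<le> 1" for i using x0 by (simp add: cube_face_def)
      ultimately show "x \<in> cube_face ?s" by (simp add: cube_face_def sgn_zero_iff)
    qed
  qed
qed

lemma polytope_cube: "polytope (cube_face (0 :: real ^ 'n))"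
  unfolding cube_face_0 by (rule polytope_interval)

lemma faces_of_cube:
  "{F. F face_of cube_face (0 :: real ^ 'n) \<and> F \<noteq> {}} = cube_face ` sign_vectors"
proof (intro equalityI subsetI)
  fix F assume "F \<in> {F. F face_of cube_face (0 :: real ^ 'n) \<and> F \<noteq> {}}"
  then obtain c where "F = max_face (cube_face 0) c"
    using face_of_polytope_eq_max_face[OF polytope_cube] by blast
  then show "F \<in> cube_face ` sign_vectors"
    unfolding max_face_cube by (auto simp: sign_vectors_def sgn_if)
next
  fix F :: "(real ^ 'n) set" assume "F \<in> cube_face ` sign_vectors"
  then obtain s where s: "s \<in> sign_vectors" "F = cube_face s" by blast
  \<comment> \<open>A sign vector is its own sign pattern, so it is a normal vector of its own
    face.\<close>
  have "(\<chi> i. sgn (s $ i)) = s"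
    using s(1) by (auto simp: vec_eq_iff sign_vectors_def sgn_if) (smt (verit))+
  then have "F = max_face (cube_face 0) s" by (simp add: max_face_cube s)
  then have "F face_of cube_face 0"
    using max_face_face_of[OF polytope_imp_convex[OF polytope_cube]] by simp
  then show "F \<in> {F. F face_of cube_face (0 :: real ^ 'n) \<and> F \<noteq> {}}"
    using sign_vector_in_cube_face s by blast
qed

text \<open>Translated by \<open>- s\<close>, the face is a coordinate subspace \<open>W\<close> cut
  with a box \<open>B\<close> around the origin, which keeps the dimension of
  \<open>W\<close>.\<close>

lemma aff_dim_cube_face:
  fixes s :: "real ^ 'n"
  shows "aff_dim (cube_face s) = int (card {i. s $ i = 0})"
proof -
  define W where "W = {x :: real ^ 'n. \<forall>i. i \<notin> {i. s $ i = 0} \<longrightarrow> x $ i = 0}"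
  define B where "B = {x :: real ^ 'n. \<forall>i. \<bar>x $ i\<bar> \<le> 1}"
  have W: "subspace W" by (auto simp: W_def subspace_def)
  have "ball 0 1 \<subseteq> B"
    unfolding B_def using component_le_norm_cart by (fastforce intro: order_trans)
  then have "0 \<in> interior B" by (meson interiorI open_ball centre_in_ball zero_less_one)
  moreover have "0 \<in> W" by (simp add: W_def)
  ultimately have "aff_dim (W \<inter> B) = aff_dim W"
    using aff_dim_convex_Int_nonempty_interior[OF subspace_imp_convex[OF W]] by blast
  moreover have "cube_face s = (+) s ` (W \<inter> B)"
  proof
    show "(+) s ` (W \<inter> B) \<subseteq> cube_face s" by (auto simp: cube_face_def W_def B_def)
    show "cube_face s \<subseteq> (+) s ` (W \<inter> B)"
    proof
      fix x assume x: "x \<in> cube_face s"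
      have "x - s \<in> W \<inter> B"
        using x by (auto simp: cube_face_def W_def B_def split: if_splits)
          (metis abs_zero diff_self diff_zero zero_le_one)
      then show "x \<in> (+) s ` (W \<inter> B)" by (rule rev_image_eqI) simp
    qed
  qed
  moreover have "dim W = card {i. s $ i = 0}"
    unfolding W_def using dim_substandard_cart[of "{i. s $ i = 0}", where 'a = real]
    by (simp add: dim_vec_eq)
  ultimately show ?thesis
    using aff_dim_subspace[OF W] by (simp add: aff_dim_translation_eq)
qed

text \<open>The coordinates are chosen independently: two values on \<open>A\<close>, one on
  \<open>Z\<close>, three elsewhere.\<close>

lemma card_sign_vectors_nonzero_on:
  fixes A Z :: "'n::finite set"
  assumes "A \<inter> Z = {}"
  shows "card {s :: real ^ 'n. s \<in> sign_vectors \<and> (\<forall>i\<in>A. s $ i \<noteq> 0) \<and> (\<forall>i\<in>Z. s $ i = 0)}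
    = 2 ^ card A * 3 ^ card (- (A \<union> Z))"
proof -
  let ?B = "\<lambda>i. if i \<in> A then {-1, 1} else if i \<in> Z then {0} else {-1, 0, 1 :: real}"
  have "bij_betw vec_nth {s :: real ^ 'n. s \<in> sign_vectors \<and> (\<forall>i\<in>A. s $ i \<noteq> 0) \<and> (\<forall>i\<in>Z. s $ i = 0)}
    (PiE UNIV ?B)"
    by (rule bij_betw_byWitness[where f' = vec_lambda])
      (use assms in \<open>auto simp: sign_vectors_def PiE_def Pi_def split: if_splits\<close>)
  then have "card {s :: real ^ 'n. s \<in> sign_vectors \<and> (\<forall>i\<in>A. s $ i \<noteq> 0) \<and> (\<forall>i\<in>Z. s $ i = 0)}
    = (\<Prod>i\<in>UNIV. card (?B i))"
    by (simp add: bij_betw_same_card card_PiE)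
  also have "\<dots> = (\<Prod>i\<in>UNIV. (if i \<in> A then 2 else 1) * (if i \<in> - (A \<union> Z) then 3 else 1))"
    using assms by (intro prod.cong) (auto simp: card_insert_if)
  also have "\<dots> = 2 ^ card A * 3 ^ card (- (A \<union> Z))"
    by (simp only: prod.distrib prod.If_cases finite prod_constant Int_UNIV_left power_one mult_1_right
        Collect_mem_eq)
  finally show ?thesis .
qed

text \<open>A flag of the cube is given by the sign vector of its smaller face and the set \<open>A\<close> of
  coordinates that are freed in the larger face.\<close>

lemma card_flags_cube:
  assumes "k < CARD('n)"
  shows "card (flags k (cube_face (0 :: real ^ 'n))) =
    (CARD('n) choose (k + 1)) * 2 ^ (CARD('n) - k - 1) * (3 ^ (k + 1) - 1)"
proof -
  let ?d = "CARD('n)"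
  \<comment> \<open>The number of freed coordinates: for flags counted by \<open>k\<close>, the
    dimensions of the two faces differ by \<open>d - 1 - k\<close>.\<close>
  define m where "m = ?d - k - 1"
  \<comment> \<open>Only coordinates fixed in the smaller face can be freed, and one must stay fixed
    so that the larger face is not the whole cube.\<close>
  define T where "T A = {s :: real ^ 'n. s \<in> sign_vectors \<and> (\<forall>i\<in>A. s $ i \<noteq> 0) \<and> (\<exists>i. i \<notin> A \<and> s $ i \<noteq> 0)}" for A
  define free :: "'n set \<Rightarrow> real ^ 'n \<Rightarrow> real ^ 'n" where "free A s = (\<chi> i. if i \<in> A then 0 else s $ i)" for A s
  let ?T = "Sigma {A. card A = m} T"
  let ?f = "\<lambda>(A, s). (cube_face s, cube_face (free A s))"
  have free: "free A s \<in> sign_vectors" if "s \<in> sign_vectors" for A s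
    using that by (auto simp: free_def sign_vectors_def)
  have zero: "0 \<in> (sign_vectors :: (real ^ 'n) set)" by (simp add: sign_vectors_def)
  have dim: "DIM(real ^ 'n) = ?d" by simp
  have inj: "inj_on ?f ?T"
  proof (rule inj_onI, clarify)
    fix A s A' s'
    assume s: "s \<in> T A" "s' \<in> T A'" and eq: "cube_face s = cube_face s'"
      "cube_face (free A s) = cube_face (free A' s')"
    then have sv: "s \<in> sign_vectors" "s' \<in> sign_vectors" by (auto simp: T_def)
    have ss: "s = s'" using eq(1) sv inj_on_cube_face by (auto dest: inj_onD)
    have fr: "free A s = free A' s'" using eq(2) sv free inj_on_cube_face by (auto dest: inj_onD)
    \<comment> \<open>The set \<open>A\<close> is recovered as the coordinates that are fixed in the
      smaller face and free in the larger one.\<close>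
    have "i \<in> A \<longleftrightarrow> s $ i \<noteq> 0 \<and> free A s $ i = 0" "i \<in> A' \<longleftrightarrow> s' $ i \<noteq> 0 \<and> free A' s' $ i = 0" for i
      using s by (auto simp: T_def free_def)
    then show "A = A' \<and> s = s'" using ss fr by auto
  qed
  have image: "?f ` ?T = flags k (cube_face (0 :: real ^ 'n))"
  proof (intro equalityI subsetI)
    fix p assume "p \<in> ?f ` ?T"
    then obtain A s where p: "p = (cube_face s, cube_face (free A s))" and A: "card A = m" and s: "s \<in> T A"
      by auto
    have sv: "s \<in> sign_vectors" using s by (simp add: T_def)
    have "cube_face s \<in> cube_face ` sign_vectors" "cube_face (free A s) \<in> cube_face ` sign_vectors"
      using sv free by auto
    then have faces: "cube_face s face_of cube_face 0" "cube_face s \<noteq> {}" "cube_face (free A s) face_of cube_face 0"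
      unfolding faces_of_cube[symmetric] by auto
    have "free A s \<noteq> 0" using s by (auto simp: T_def free_def vec_eq_iff)
    then have "cube_face (free A s) \<noteq> cube_face 0"
      using inj_onD[OF inj_on_cube_face _ free[OF sv] zero] by blast
    moreover have "cube_face s \<subseteq> cube_face (free A s)"
      by (subst cube_face_subset_iff[OF sv free[OF sv]]) (simp add: free_def)
    moreover have "{i. free A s $ i = 0} = A \<union> {i. s $ i = 0}" by (auto simp: free_def)
    then have "card {i. free A s $ i = 0} = m + card {i. s $ i = 0}"
      using s A by (subst A[symmetric]) (auto simp: T_def intro!: card_Un_disjoint)
    ultimately show "p \<in> flags k (cube_face 0)"
      using faces assms by (simp add: p flags_def aff_dim_cube_face m_def)
  next
    fix p assume "p \<in> flags k (cube_face (0 :: real ^ 'n))"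
    then obtain G F where p: "p = (G, F)" and GF: "G face_of cube_face 0" "G \<noteq> {}" "F face_of cube_face 0"
      "F \<noteq> cube_face 0" "G \<subseteq> F" "aff_dim G + int ?d = aff_dim F + 1 + int k"
      by (auto simp: flags_def)
    have "G \<in> cube_face ` sign_vectors" "F \<in> cube_face ` sign_vectors"
      unfolding faces_of_cube[symmetric] using GF by auto
    then obtain s t where st: "s \<in> sign_vectors" "G = cube_face s" "t \<in> sign_vectors" "F = cube_face t"
      by blast
    define A where "A = {i. t $ i = 0 \<and> s $ i \<noteq> 0}"
    have agree: "t $ i \<noteq> 0 \<Longrightarrow> s $ i = t $ i" for i
      using GF(5) st cube_face_subset_iff by blast
    have agree0: "t $ i = 0" if "s $ i = 0" for i
      using agree[of i] that by (cases "t $ i = 0") auto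
    have "t $ i = free A s $ i" for i
      using agree[of i] agree0[of i] by (cases "t $ i = 0") (auto simp: free_def A_def)
    then have tA: "t = free A s" by (simp add: vec_eq_iff)
    from agree0 have "{i. t $ i = 0} = A \<union> {i. s $ i = 0}" by (auto simp: A_def)
    moreover have "A \<inter> {i. s $ i = 0} = {}" by (auto simp: A_def)
    ultimately have "card {i. t $ i = 0} = card A + card {i. s $ i = 0}"
      by (simp add: card_Un_disjoint)
    then have "card A = m" using GF(6) by (simp add: st aff_dim_cube_face m_def)
    moreover have "t \<noteq> 0" using GF(4) st by auto
    then have "s \<in> T A" using st(1) agree by (auto simp: T_def A_def vec_eq_iff)
    ultimately show "p \<in> ?f ` ?T"
      using p st tA by (auto intro!: image_eqI[of _ _ "(A, s)"])
  qed
  have "card (flags k (cube_face (0 :: real ^ 'n))) = card ?T"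
    unfolding image[symmetric] using inj by (rule card_image)
  also have "\<dots> = (\<Sum>A\<in>{A. card A = m}. card (T A))"
  proof (rule card_SigmaI)
    have "finite (sign_vectors :: (real ^ 'n) set)"
      using card_sign_vectors_nonzero_on[of "{}" "{} :: 'n set"]
      by (intro card_ge_0_finite) simp
    then show "\<forall>A\<in>{A. card A = m}. finite (T A)"
      by (auto simp: T_def intro: finite_subset)
  qed simp
  also have "\<dots> = (\<Sum>A\<in>{A :: 'n set. card A = m}. 2 ^ m * (3 ^ (k + 1) - 1))"
  proof (rule sum.cong[OF refl], clarify)
    fix A :: "'n set" assume m: "m = card A"
    let ?N = "\<lambda>Z. {s :: real ^ 'n. s \<in> sign_vectors \<and> (\<forall>i\<in>A. s $ i \<noteq> 0) \<and> (\<forall>i\<in>Z. s $ i = 0)}"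
    \<comment> \<open>From all sign vectors nonzero on \<open>A\<close>, those vanishing off
      \<open>A\<close> are removed: for them the larger face would be the whole cube. This produces
      the term \<open>- 1\<close> next to the power of 3.\<close>
    have "T A = ?N {} - ?N (- A)" by (auto simp: T_def)
    moreover have "card (- A) = k + 1"
      using m assms by (simp add: m_def Compl_eq_Diff_UNIV card_Diff_subset)
    then have c: "card (?N {}) = 2 ^ card A * 3 ^ (k + 1)" "card (?N (- A)) = 2 ^ card A"
      using card_sign_vectors_nonzero_on[of A "{}"] card_sign_vectors_nonzero_on[of A "- A"]
      by auto
    moreover have "finite (?N (- A))" using c(2) by (intro card_ge_0_finite) simp
    ultimately have "card (T A) = 2 ^ card A * 3 ^ (k + 1) - 2 ^ card A"
      by (simp only:) (subst card_Diff_subset, auto)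
    then show "card (T A) = 2 ^ card A * (3 ^ (k + 1) - 1)" by (simp add: diff_mult_distrib2)
  qed
  also have "\<dots> = (?d choose m) * (2 ^ m * (3 ^ (k + 1) - 1))"
    using n_subsets[of "UNIV :: 'n set" m] by simp
  also have "?d choose m = ?d choose (k + 1)"
    using binomial_symmetric[of "k + 1" ?d] assms by (simp add: m_def)
  finally show ?thesis by (simp add: m_def mult.assoc)
qed

theorem theorem7:
  fixes P :: "(real ^ 'n) set" and d k :: nat
  assumes "d = CARD('n)"
    and "is_cube P"
    and "perfectly_centered P"
    and "k \<le> d - 1"
  shows "face_number k (P + dual_body P)
           = (d choose (k + 1)) * 2 ^ (d - k - 1) * (3 ^ (k + 1) - 1)"
proof -
  \<comment> \<open>Subtraction is truncated in \<open>k \<le> d - 1\<close>; positivity of the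
    dimension makes the bound strict.\<close>
  have k: "k < CARD('n)" using assms(1,4) zero_less_card_finite[where 'a = 'n] by linarith
  have "face_number k (P + dual_body P) = card (flags k P)"
    using assms(3) k by (simp add: face_number_sum_dual)
  also have "\<dots> = card (flags k (cube_face (0 :: real ^ 'n)))"
    using assms(2) polytope_cube
    by (intro card_flags_combinatorially_equivalent) (auto simp: is_cube_def cube_face_0)
  also have "\<dots> = (d choose (k + 1)) * 2 ^ (d - k - 1) * (3 ^ (k + 1) - 1)"
    using card_flags_cube[OF k] assms(1) by simp
  finally show ?thesis .
qed

end
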